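(* Let $0<\rho_1<\rho_2$, $h_1,h_2>0$, let $g>0$ be the acceleration of gravity, let $U_x\in\mathbb{R}$ be a constant (the speed of the ship), and let $$U_c=\sqrt{\frac{(\rho_2-\rho_1)g}{\rho_1/h_1+\rho_2/h_2}}.$$ Let $v_p(\kappa)=\dfrac{\omega_\kappa}{2\pi|\kappa|}$ denote the phase velocity. If $U_x<U_c$, there exists a unique $\kappa_c^\star>0$ such that $v_p(\kappa_c^\star)=U_x$. If $U_x>U_c$, there is no $k_c>0$ such that $v_p(k_c)=U_x$.
   Context: One-dimensional wave propagation (wave number $\kappa\in\mathbb{R}$) at the interface of a two-layer fluid with densities $\rho_1$ (top), $\rho_2$ (bottom) and thicknesses $h_1,h_2$, without damping. The dispersion relation is, for $\kappa\neq0$, $$\omega_\kappa=\sqrt{\frac{2\pi|\kappa|(\rho_2-\rho_1)g}{T_{1,\kappa}+T_{2,\kappa}}},\qquad T_{j,\kappa}=\rho_j\coth(2\pi|\kappa| h_j)\quad(j=1,2).$$ The ship moves along the $x$-axis at constant speed $U_x$; the speed is called subcritical if $U_x<U_c$ and supercritical if $U_x>U_c$.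
   Formalization: In the subcritical claim the speed is taken positive, 0 < U_x < U_c; for U_x ≤ 0 the claim is false, because the phase velocity v_p(κ) is strictly positive for every κ > 0. *)

theory Defs
  imports Complex_Main
begin

definition coth :: "real \<Rightarrow> real" where
  "coth x = cosh x / sinh x"

definition layer_T :: "real \<Rightarrow> real \<Rightarrow> real \<Rightarrow> real" where
  "layer_T \<rho> h \<kappa> = \<rho> * coth (2 * pi * \<bar>\<kappa>\<bar> * h)"

text \<open>The dispersion relation is meant for wave numbers \<open>\<kappa> \<noteq> 0\<close>. At \<open>\<kappa> = 0\<close> the definitions
  below take junk values caused by division by zero.\<close>

definition omega :: "real \<Rightarrow> real \<Rightarrow> real \<Rightarrow> real \<Rightarrow> real \<Rightarrow> real \<Rightarrow> real" where
  "omega g \<rho>\<^sub>1 \<rho>\<^sub>2 h\<^sub>1 h\<^sub>2 \<kappa> =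
     sqrt (2 * pi * \<bar>\<kappa>\<bar> * (\<rho>\<^sub>2 - \<rho>\<^sub>1) * g / (layer_T \<rho>\<^sub>1 h\<^sub>1 \<kappa> + layer_T \<rho>\<^sub>2 h\<^sub>2 \<kappa>))"

definition phase_velocity :: "real \<Rightarrow> real \<Rightarrow> real \<Rightarrow> real \<Rightarrow> real \<Rightarrow> real \<Rightarrow> real" where
  "phase_velocity g \<rho>\<^sub>1 \<rho>\<^sub>2 h\<^sub>1 h\<^sub>2 \<kappa> = omega g \<rho>\<^sub>1 \<rho>\<^sub>2 h\<^sub>1 h\<^sub>2 \<kappa> / (2 * pi * \<bar>\<kappa>\<bar>)"

definition critical_speed :: "real \<Rightarrow> real \<Rightarrow> real \<Rightarrow> real \<Rightarrow> real \<Rightarrow> real" where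
  "critical_speed g \<rho>\<^sub>1 \<rho>\<^sub>2 h\<^sub>1 h\<^sub>2 = sqrt ((\<rho>\<^sub>2 - \<rho>\<^sub>1) * g / (\<rho>\<^sub>1 / h\<^sub>1 + \<rho>\<^sub>2 / h\<^sub>2))"

end

theory Submission
  imports Defs
begin

text \<open>Write \<open>A = (\<rho>\<^sub>2 - \<rho>\<^sub>1) g\<close> and \<open>\<Phi> \<kappa> = 2 \<pi> \<kappa> (T\<^sub>1 + T\<^sub>2)\<close>. For \<open>\<kappa> > 0\<close> the phase velocity
  is \<open>sqrt (A / \<Phi> \<kappa>)\<close>, while \<open>U\<^sub>c = sqrt (A / L)\<close> with \<open>L = \<rho>\<^sub>1 / h\<^sub>1 + \<rho>\<^sub>2 / h\<^sub>2\<close>. Since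
  \<open>x coth x\<close> is strictly increasing and \<open>max 1 x \<le> x coth x \<le> 1 + x\<close> for \<open>x > 0\<close>, the
  function \<open>\<Phi>\<close> is strictly increasing and satisfies \<open>max L t \<le> \<Phi> \<kappa> \<le> L + t\<close> for
  \<open>t = 2 \<pi> \<kappa> (\<rho>\<^sub>1 + \<rho>\<^sub>2)\<close>. Hence \<open>\<Phi>\<close> takes every value above \<open>L\<close> exactly once and no value
  below \<open>L\<close>.\<close>

text \<open>The difference of the two sides vanishes at 0 and has derivative
  \<open>cosh y - 1\<close>. This bound serves both the upper estimate and the monotonicity of
  \<open>x * coth x\<close>.\<close>

lemma less_sinh:
  fixes x :: real
  assumes "0 < x"
  shows "x < sinh x"
proof -
  have "sinh 0 - 0 < sinh x - x"
  proof (rule DERIV_pos_imp_increasing_open[OF assms])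
    fix y :: real assume "0 < y" "y < x"
    then have "cosh y > cosh 0"
      by (subst cosh_real_nonneg_less_iff) auto
    then have "cosh y - 1 > 0" by simp
    moreover have "((\<lambda>y. sinh y - y) has_real_derivative cosh y - 1) (at y)"
      by (auto intro!: derivative_eq_intros)
    ultimately show "\<exists>d. ((\<lambda>y. sinh y - y) has_real_derivative d) (at y) \<and> 0 < d"
      by blast
  qed (auto intro!: continuous_intros)
  then show ?thesis by simp
qed

text \<open>In the derivative of \<open>y * cosh y - sinh y\<close> the \<open>cosh\<close> terms
  cancel, leaving \<open>y * sinh y > 0\<close>.\<close>

lemma sinh_less_mult_cosh:
  fixes x :: real
  assumes "0 < x"
  shows "sinh x < x * cosh x"
proof -
  have "0 * cosh 0 - sinh 0 < x * cosh x - sinh x"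
  proof (rule DERIV_pos_imp_increasing_open[OF assms])
    fix y :: real assume "0 < y"
    then have "0 < y * sinh y" by simp
    moreover have "((\<lambda>y. y * cosh y - sinh y) has_real_derivative y * sinh y) (at y)"
      by (auto intro!: derivative_eq_intros)
    ultimately show "\<exists>d. ((\<lambda>y. y * cosh y - sinh y) has_real_derivative d) (at y) \<and> 0 < d"
      by blast
  qed (auto intro!: continuous_intros)
  then show ?thesis by simp
qed

lemma one_less_mult_coth:
  assumes "0 < x"
  shows "1 < x * coth x"
  using assms sinh_less_mult_cosh[OF assms] by (simp add: coth_def field_simps)

lemma less_mult_coth:
  assumes "0 < x"
  shows "x < x * coth x"
  using assms sinh_less_cosh_real[of x] by (simp add: coth_def field_simps)

text \<open>After multiplication by \<open>sinh x\<close> the claim reads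
  \<open>x * (cosh x - sinh x) < sinh x\<close>, and the left side is
  \<open>x * exp (- x)\<close>.\<close>

lemma mult_coth_less:
  assumes "0 < x"
  shows "x * coth x < 1 + x"
proof -
  have "x * (cosh x - sinh x) = x * exp (- x)"
    by (simp add: cosh_minus_sinh)
  also have "\<dots> < x" using assms by simp
  also have "\<dots> < sinh x" by (rule less_sinh[OF assms])
  finally show ?thesis
    using assms by (simp add: coth_def field_simps)
qed

text \<open>The numerator of the derivative is half of \<open>sinh (2 * z) - 2 * z\<close>, hence
  positive by \<open>less_sinh\<close> at \<open>2 * z\<close>.\<close>

lemma mult_coth_strict_mono:
  assumes "0 < x" "x < y"
  shows "x * coth x < y * coth y"
proof (rule DERIV_pos_imp_increasing[OF assms(2)])
  fix z :: real assume "x \<le> z"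
  with assms have z: "0 < z" by simp
  let ?d = "(sinh z * cosh z - z) / (sinh z)\<^sup>2"
  have "2 * z < sinh (2 * z)" by (rule less_sinh) (use z in simp)
  then have "0 < ?d" using z by (simp add: sinh_double)
  moreover have "((\<lambda>z. z * coth z) has_real_derivative ?d) (at z)"
    unfolding coth_def using z cosh_square_eq[of z]
    by (auto intro!: derivative_eq_intros simp: field_simps power2_eq_square)
  ultimately show "\<exists>d. ((\<lambda>z. z * coth z) has_real_derivative d) (at z) \<and> 0 < d"
    by blast
qed

theorem theorem13:
  fixes \<rho>\<^sub>1 \<rho>\<^sub>2 h\<^sub>1 h\<^sub>2 g U\<^sub>x :: real
  assumes "0 < \<rho>\<^sub>1" and "\<rho>\<^sub>1 < \<rho>\<^sub>2"
    and "0 < h\<^sub>1" and "0 < h\<^sub>2"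
    and "0 < g"
  shows "(0 < U\<^sub>x \<and> U\<^sub>x < critical_speed g \<rho>\<^sub>1 \<rho>\<^sub>2 h\<^sub>1 h\<^sub>2 \<longrightarrow>
            (\<exists>!\<kappa>. 0 < \<kappa> \<and> phase_velocity g \<rho>\<^sub>1 \<rho>\<^sub>2 h\<^sub>1 h\<^sub>2 \<kappa> = U\<^sub>x)) \<and>
         (critical_speed g \<rho>\<^sub>1 \<rho>\<^sub>2 h\<^sub>1 h\<^sub>2 < U\<^sub>x \<longrightarrow>
            \<not> (\<exists>\<kappa>. 0 < \<kappa> \<and> phase_velocity g \<rho>\<^sub>1 \<rho>\<^sub>2 h\<^sub>1 h\<^sub>2 \<kappa> = U\<^sub>x))"
proof -
  note [simp] = assms(1,3-5)
  have [simp]: "0 < \<rho>\<^sub>2" using assms(1,2) by (rule less_trans)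
  define A where "A = (\<rho>\<^sub>2 - \<rho>\<^sub>1) * g"
  define L where "L = \<rho>\<^sub>1 / h\<^sub>1 + \<rho>\<^sub>2 / h\<^sub>2"
  define s where "s = 2 * pi * (\<rho>\<^sub>1 + \<rho>\<^sub>2)"
  \<comment> \<open>One layer's share of \<Phi>, namely
    \<open>2 * pi * \<kappa> * layer_T \<rho> h \<kappa>\<close>, rescaled so that the bounds on
    \<open>x * coth x\<close> apply with \<open>x = 2 * pi * \<kappa> * h\<close>. The factor
    \<open>\<rho> / h\<close> is its limit as \<kappa> tends to 0 from above.\<close>
  define F where "F \<rho> h \<kappa> = \<rho> / h * ((2 * pi * \<kappa> * h) * coth (2 * pi * \<kappa> * h))" for \<rho> h \<kappa>
  define \<Phi> where "\<Phi> \<kappa> = F \<rho>\<^sub>1 h\<^sub>1 \<kappa> + F \<rho>\<^sub>2 h\<^sub>2 \<kappa>" for \<kappa>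
  let ?v = "phase_velocity g \<rho>\<^sub>1 \<rho>\<^sub>2 h\<^sub>1 h\<^sub>2"
  have [simp]: "0 < A" "0 < L" "0 < s" using assms by (simp_all add: A_def L_def s_def add_pos_pos)
  have F_gt: "\<rho> / h < F \<rho> h \<kappa>" "2 * pi * \<rho> * \<kappa> < F \<rho> h \<kappa>"
    and F_lt: "F \<rho> h \<kappa> < \<rho> / h + 2 * pi * \<rho> * \<kappa>"
    if "0 < \<rho>" "0 < h" "0 < \<kappa>" for \<rho> h \<kappa>
  proof -
    have x: "0 < 2 * pi * \<kappa> * h" and r: "0 < \<rho> / h" using that by simp_all
    show "\<rho> / h < F \<rho> h \<kappa>" "2 * pi * \<rho> * \<kappa> < F \<rho> h \<kappa>"
      "F \<rho> h \<kappa> < \<rho> / h + 2 * pi * \<rho> * \<kappa>"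
      using mult_strict_left_mono[OF one_less_mult_coth[OF x] r]
        mult_strict_left_mono[OF less_mult_coth[OF x] r]
        mult_strict_left_mono[OF mult_coth_less[OF x] r] that
      unfolding F_def distrib_left by (simp_all add: mult_ac)
  qed
  have F_mono: "F \<rho> h \<kappa> < F \<rho> h \<kappa>'" if "0 < \<rho>" "0 < h" "0 < \<kappa>" "\<kappa> < \<kappa>'" for \<rho> h \<kappa> \<kappa>'
    unfolding F_def using that by (intro mult_strict_left_mono mult_coth_strict_mono) auto
  have \<Phi>_gt: "L < \<Phi> \<kappa>" "s * \<kappa> < \<Phi> \<kappa>" and \<Phi>_lt: "\<Phi> \<kappa> < L + s * \<kappa>" if "0 < \<kappa>" for \<kappa>
    using F_gt[of \<rho>\<^sub>1 h\<^sub>1 \<kappa>] F_gt[of \<rho>\<^sub>2 h\<^sub>2 \<kappa>] F_lt[of \<rho>\<^sub>1 h\<^sub>1 \<kappa>] F_lt[of \<rho>\<^sub>2 h\<^sub>2 \<kappa>] that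
    unfolding \<Phi>_def L_def s_def by (simp_all add: algebra_simps)
  have \<Phi>_mono: "\<Phi> \<kappa> < \<Phi> \<kappa>'" if "0 < \<kappa>" "\<kappa> < \<kappa>'" for \<kappa> \<kappa>'
    unfolding \<Phi>_def using that by (intro add_strict_mono F_mono) auto
  have F_cont: "continuous_on {a..b} (F \<rho> h)" if "0 < h" "0 < a" for \<rho> h a b
    unfolding F_def[abs_def] coth_def by (intro continuous_intros) (use that in auto)
  have \<Phi>_cont: "continuous_on {a..b} \<Phi>" if "0 < a" for a b
    unfolding \<Phi>_def[abs_def] using that by (intro continuous_on_add F_cont) simp_all
  have F_eq: "F \<rho> h \<kappa> = 2 * pi * \<kappa> * layer_T \<rho> h \<kappa>" if "0 < h" "0 < \<kappa>" for \<rho> h \<kappa>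
    using that by (simp add: F_def layer_T_def)
  have v_eq: "?v \<kappa> = sqrt (A / \<Phi> \<kappa>)" if "0 < \<kappa>" for \<kappa>
  proof -
    define T where "T = layer_T \<rho>\<^sub>1 h\<^sub>1 \<kappa> + layer_T \<rho>\<^sub>2 h\<^sub>2 \<kappa>"
    define k where "k = 2 * pi * \<kappa>"
    have k: "0 < k" "2 * pi * \<bar>\<kappa>\<bar> = k" using that by (simp_all add: k_def)
    have \<Phi>: "\<Phi> \<kappa> = k * T"
      using that by (simp add: \<Phi>_def F_eq T_def k_def distrib_left)
    \<comment> \<open>Since \<open>k > 0\<close>, the denominator can be written as
      \<open>sqrt (k\<^sup>2)\<close> and moved under the root.\<close>
    have "?v \<kappa> = sqrt (k * A / T) / sqrt (k\<^sup>2)"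
      using k by (simp add: phase_velocity_def omega_def T_def A_def mult.assoc)
    also have "\<dots> = sqrt (k * A / T / k\<^sup>2)"
      by (simp only: real_sqrt_divide)
    also have "k * A / T / k\<^sup>2 = A / \<Phi> \<kappa>"
      using k by (simp add: \<Phi> power2_eq_square)
    finally show ?thesis .
  qed
  have Uc_eq: "critical_speed g \<rho>\<^sub>1 \<rho>\<^sub>2 h\<^sub>1 h\<^sub>2 = sqrt (A / L)"
    by (simp add: critical_speed_def A_def L_def)
  have \<Phi>_pos: "0 < \<Phi> \<kappa>" if "0 < \<kappa>" for \<kappa>
    using \<open>0 < L\<close> \<Phi>_gt(1)[OF that] by (rule less_trans)
  have v_less: "?v \<kappa> < sqrt (A / L)" if "0 < \<kappa>" for \<kappa>
    using \<Phi>_gt(1)[OF that] \<Phi>_pos[OF that]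
    by (simp add: v_eq[OF that] divide_strict_left_mono)
  \<comment> \<open>The phase velocity is positive for \<open>\<kappa> > 0\<close>, so existence
    requires \<open>0 < U\<^sub>x\<close>.\<close>
  have "\<exists>!\<kappa>. 0 < \<kappa> \<and> ?v \<kappa> = U\<^sub>x" if U: "0 < U\<^sub>x" "U\<^sub>x < sqrt (A / L)"
  proof -
    \<comment> \<open>The level that \<Phi> must attain, from solving
      \<open>sqrt (A / \<Phi> \<kappa>) = U\<^sub>x\<close>.\<close>
    define c where "c = A / U\<^sub>x\<^sup>2"
    have "U\<^sub>x\<^sup>2 < A / L" using U real_sqrt_less_iff[of "U\<^sub>x\<^sup>2" "A / L"] by simp
    then have c: "L < c" using U by (simp add: c_def pos_less_divide_eq mult.commute)
    have v_iff: "?v \<kappa> = U\<^sub>x \<longleftrightarrow> \<Phi> \<kappa> = c" if "0 < \<kappa>" for \<kappa>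
    proof -
      have "?v \<kappa> = U\<^sub>x \<longleftrightarrow> A / \<Phi> \<kappa> = U\<^sub>x\<^sup>2"
        using U real_sqrt_eq_iff[of "A / \<Phi> \<kappa>" "U\<^sub>x\<^sup>2"] by (simp add: v_eq[OF that])
      also have "\<dots> \<longleftrightarrow> \<Phi> \<kappa> = c"
        using U \<Phi>_pos[OF that] by (auto simp: c_def nonzero_divide_eq_eq nonzero_eq_divide_eq mult.commute)
      finally show ?thesis .
    qed
    \<comment> \<open>The endpoints solve \<open>L + s * \<kappa> = c\<close> and
      \<open>s * \<kappa> = c\<close>, where the upper and lower bounds on \<Phi> reach
      \<open>c\<close>. The left one is positive because \<open>L < c\<close>, which keeps the
      interval away from the singularity of \<open>coth\<close> at 0.\<close>
    have a: "0 < (c - L) / s" "(c - L) / s \<le> c / s"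
      using c by (simp_all add: diff_divide_distrib[of c L s] divide_strict_right_mono less_imp_le)
    then have b: "0 < c / s" by linarith
    have "\<Phi> ((c - L) / s) \<le> c" "c \<le> \<Phi> (c / s)"
      using \<Phi>_lt[OF a(1)] \<Phi>_gt(2)[OF b] \<open>0 < s\<close> by simp_all
    from IVT'[OF this a(2) \<Phi>_cont[OF a(1)]]
    obtain \<kappa> where "(c - L) / s \<le> \<kappa>" "\<Phi> \<kappa> = c" by blast
    with a(1) have \<kappa>: "0 < \<kappa>" "\<Phi> \<kappa> = c" by (blast intro: less_le_trans)+
    show ?thesis
    proof (rule ex1I[of _ \<kappa>])
      show "0 < \<kappa> \<and> ?v \<kappa> = U\<^sub>x" using \<kappa> v_iff by simp
      show "\<kappa>' = \<kappa>" if "0 < \<kappa>' \<and> ?v \<kappa>' = U\<^sub>x" for \<kappa>'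
        using that \<kappa> v_iff[of \<kappa>'] \<Phi>_mono[of \<kappa> \<kappa>'] \<Phi>_mono[of \<kappa>' \<kappa>]
        by (cases \<kappa>' \<kappa> rule: linorder_cases) auto
    qed
  qed
  moreover have "\<not> (\<exists>\<kappa>. 0 < \<kappa> \<and> ?v \<kappa> = U\<^sub>x)" if "sqrt (A / L) < U\<^sub>x"
    using that v_less by force
  ultimately show ?thesis unfolding Uc_eq by blast
qed

end
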